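(* Let $X$ and $Y$ be bounded metric spaces with $\operatorname{diam} X\le\operatorname{diam} Y$. Assume that for some real $\lambda$ with $0<\lambda<\operatorname{diam} Y$ and some cardinal number $m$ with $\#X<m\le\#Y$ we have $2\,d_{GH}(\lambda\Delta_m,Y)=\operatorname{diam} Y$. Then $$2\,d_{GH}(X,Y)=\operatorname{diam} Y,$$ where $d_{GH}$ is the Gromov--Hausdorff distance.
   Context: All metric spaces are nonempty, and $\#X$ denotes the cardinality of $X$ (possibly infinite). For a cardinal number $m$, $\Delta_m$ denotes the single-distance metric space of cardinality $m$ in which all nonzero distances equal $1$; for real $\lambda>0$, $\lambda\Delta_m$ is obtained from it by multiplying all distances by $\lambda$. Gromov--Hausdorff distance: for metric spaces $X,Y$, $d_{GH}(X,Y)$ is the infimum of real numbers $r$ for which there exist a metric space $Z$ and subsets $X',Y'\subset Z$ isometric to $X$ and $Y$, respectively, with Hausdorff distance $d_H(X',Y')\le r$. Equivalently, $d_{GH}(X,Y)=\frac12\inf\{\operatorname{dis}R\}$ over all correspondences $R\subset X\times Y$ (subsets that project onto both $X$ and $Y$), where $\operatorname{dis}R=\sup\{\,||xx'|-|yy'||:(x,y),(x',y')\in R\}$. The spaces are not assumed to be compact. *)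

theory Defs
  imports "HOL-Analysis.Analysis" "HOL-Library.Equipollence"
begin

definition mdiam :: "'a metric \<Rightarrow> ereal" where
  "mdiam X = (SUP p \<in> mspace X \<times> mspace X. ereal (mdist X (fst p) (snd p)))"

definition bounded_metric :: "'a metric \<Rightarrow> bool" where
  "bounded_metric X \<longleftrightarrow> Metric_space.mbounded (mspace X) (mdist X) (mspace X)"

definition isometric_metric :: "'a metric \<Rightarrow> 'b metric \<Rightarrow> bool" where
  "isometric_metric X Y \<longleftrightarrow>
     (\<exists>f. bij_betw f (mspace X) (mspace Y) \<and>
        (\<forall>x\<in>mspace X. \<forall>x'\<in>mspace X. mdist Y (f x) (f x') = mdist X x x'))"

definition single_distance_metric :: "'a set \<Rightarrow> 'a metric" where
  "single_distance_metric M = metric (M, \<lambda>x y. if x = y then 0 else 1)"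

text \<open>Only meaningful for a positive factor; otherwise the rescaled function need not be a metric.\<close>

definition scale_metric :: "real \<Rightarrow> 'a metric \<Rightarrow> 'a metric" where
  "scale_metric c X = metric (mspace X, \<lambda>x y. c * mdist X x y)"

definition hausdorff_dist :: "'a metric \<Rightarrow> 'a set \<Rightarrow> 'a set \<Rightarrow> ereal" where
  "hausdorff_dist Z A B =
     Inf {ereal r | r. 0 < r \<and> A \<subseteq> (\<Union>b\<in>B. mball_of Z b r) \<and> B \<subseteq> (\<Union>a\<in>A. mball_of Z a r)}"

text \<open>The ambient space ranges over the metric spaces carried by a subset of the disjoint sum type.
  This is no restriction: the Hausdorff distance only involves the union of the two isometric
  copies, which always fits into that type. The lemma \<open>gh_dist_le\<close> below confirms that
  ambient spaces over any other type give nothing smaller.\<close>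

definition gh_dist :: "'a metric \<Rightarrow> 'b metric \<Rightarrow> ereal" where
  "gh_dist X Y =
     Inf {ereal r | r. \<exists>(Z :: ('a + 'b) metric) X' Y'.
       X' \<subseteq> mspace Z \<and> Y' \<subseteq> mspace Z \<and>
       isometric_metric X (submetric Z X') \<and> isometric_metric Y (submetric Z Y') \<and>
       hausdorff_dist Z X' Y' \<le> ereal r}"

definition correspondence :: "'a set \<Rightarrow> 'b set \<Rightarrow> ('a \<times> 'b) set \<Rightarrow> bool" where
  "correspondence A B R \<longleftrightarrow> R \<subseteq> A \<times> B \<and> fst ` R = A \<and> snd ` R = B"

definition distortion :: "'a metric \<Rightarrow> 'b metric \<Rightarrow> ('a \<times> 'b) set \<Rightarrow> ereal" where
  "distortion X Y R =
     (SUP q \<in> R \<times> R.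
        ereal \<bar>mdist X (fst (fst q)) (fst (snd q)) - mdist Y (snd (fst q)) (snd (snd q))\<bar>)"


lemma Metric_space_single_distance: "Metric_space M (\<lambda>x y. if x = y then 0 else (1::real))"
  by unfold_locales auto

lemma mspace_single_distance_metric [simp]: "mspace (single_distance_metric M) = M"
  and mdist_single_distance_metric [simp]:
    "mdist (single_distance_metric M) x y = (if x = y then 0 else 1)"
  unfolding single_distance_metric_def
  using Metric_space.mspace_metric[OF Metric_space_single_distance]
    Metric_space.mdist_metric[OF Metric_space_single_distance] by metis+

lemma Metric_space_scale:
  assumes "c > 0"
  shows "Metric_space (mspace X) (\<lambda>x y. c * mdist X x y)"
proof
  fix x y z assume "x \<in> mspace X" "y \<in> mspace X" "z \<in> mspace X"
  then show "c * mdist X x z \<le> c * mdist X x y + c * mdist X y z"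
    using assms by (metis mdist_triangle distrib_left mult_le_cancel_left_pos)
qed (use assms in \<open>auto simp: mdist_commute\<close>)

lemma mspace_scale_metric [simp]: "c > 0 \<Longrightarrow> mspace (scale_metric c X) = mspace X"
  and mdist_scale_metric [simp]: "c > 0 \<Longrightarrow> mdist (scale_metric c X) x y = c * mdist X x y"
  unfolding scale_metric_def
  using Metric_space.mspace_metric[OF Metric_space_scale]
    Metric_space.mdist_metric[OF Metric_space_scale] by metis+

lemma hausdorff_correspondence:
  fixes X :: "'a metric" and Y :: "'b metric" and Z :: "'c metric"
  assumes "X' \<subseteq> mspace Z" "Y' \<subseteq> mspace Z"
    and "isometric_metric X (submetric Z X')" "isometric_metric Y (submetric Z Y')"
    and less: "hausdorff_dist Z X' Y' < ereal r"
  obtains R where "correspondence (mspace X) (mspace Y) R" "distortion X Y R \<le> ereal (2 * r)"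
proof -
  obtain f where f: "bij_betw f (mspace X) X'"
    "\<And>x x'. x \<in> mspace X \<Longrightarrow> x' \<in> mspace X \<Longrightarrow> mdist Z (f x) (f x') = mdist X x x'"
    using assms(1,3) unfolding isometric_metric_def by (auto simp: inf.absorb1 inf.absorb2)
  obtain g where g: "bij_betw g (mspace Y) Y'"
    "\<And>x x'. x \<in> mspace Y \<Longrightarrow> x' \<in> mspace Y \<Longrightarrow> mdist Z (g x) (g x') = mdist Y x x'"
    using assms(2,4) unfolding isometric_metric_def by (auto simp: inf.absorb1 inf.absorb2)
  obtain s where s: "s < r" "X' \<subseteq> (\<Union>b\<in>Y'. mball_of Z b s)" "Y' \<subseteq> (\<Union>a\<in>X'. mball_of Z a s)"
    using less unfolding hausdorff_dist_def Inf_less_iff by auto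
  define R where "R = {(x,y). x \<in> mspace X \<and> y \<in> mspace Y \<and> mdist Z (f x) (g y) < s}"
  have fX: "f x \<in> X'" if "x \<in> mspace X" for x using f(1) that by (auto simp: bij_betw_def)
  have gY: "g x \<in> Y'" if "x \<in> mspace Y" for x using g(1) that by (auto simp: bij_betw_def)
  have 1: "\<exists>y. (x,y) \<in> R" if x: "x \<in> mspace X" for x
  proof -
    obtain b where "b \<in> Y'" "mdist Z b (f x) < s" using s(2) fX[OF x] by auto
    moreover from this obtain y where "y \<in> mspace Y" "b = g y"
      using g(1) by (auto simp: bij_betw_def)
    ultimately show ?thesis using x by (auto simp: R_def mdist_commute)
  qed
  have 2: "\<exists>x. (x,y) \<in> R" if y: "y \<in> mspace Y" for y
  proof -
    obtain b where "b \<in> X'" "mdist Z b (g y) < s" using s(3) gY[OF y] by auto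
    moreover from this obtain x where "x \<in> mspace X" "b = f x"
      using f(1) by (auto simp: bij_betw_def)
    ultimately show ?thesis using y by (auto simp: R_def)
  qed
  have sub: "R \<subseteq> mspace X \<times> mspace Y" by (auto simp: R_def)
  have c: "correspondence (mspace X) (mspace Y) R"
    unfolding correspondence_def using sub 1 2 by force
  have "\<bar>mdist X x x' - mdist Y y y'\<bar> \<le> 2 * r" if "(x,y) \<in> R" "(x',y') \<in> R" for x y x' y'
  proof -
    have m: "x \<in> mspace X" "x' \<in> mspace X" "y \<in> mspace Y" "y' \<in> mspace Y"
      "mdist Z (f x) (g y) < s" "mdist Z (f x') (g y') < s"
      using that by (auto simp: R_def)
    have z: "f x \<in> mspace Z" "f x' \<in> mspace Z" "g y \<in> mspace Z" "g y' \<in> mspace Z"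
      using m fX gY assms(1,2) by blast+
    have "mdist Z (f x) (f x') \<le> mdist Z (f x) (g y) + mdist Z (g y) (f x')"
      "mdist Z (g y) (f x') \<le> mdist Z (g y) (g y') + mdist Z (g y') (f x')"
      "mdist Z (g y) (g y') \<le> mdist Z (g y) (f x) + mdist Z (f x) (g y')"
      "mdist Z (f x) (g y') \<le> mdist Z (f x) (f x') + mdist Z (f x') (g y')"
      using z by (auto intro: mdist_triangle)
    then have "\<bar>mdist Z (f x) (f x') - mdist Z (g y) (g y')\<bar> \<le> 2 * r"
      using m(5,6) s(1) mdist_commute[of Z "g y" "f x"] mdist_commute[of Z "g y'" "f x'"]
      unfolding abs_le_iff by linarith
    then show ?thesis using f(2) g(2) m by simp
  qed
  then have "distortion X Y R \<le> ereal (2 * r)"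
    unfolding distortion_def by (intro SUP_least) auto
  with c that show ?thesis by blast
qed

lemma correspondence_gh_dist_le:
  fixes X :: "'a metric" and Y :: "'b metric"
  assumes R: "correspondence (mspace X) (mspace Y) R" and ne: "mspace X \<noteq> {}"
    and dis: "distortion X Y R \<le> ereal (2 * s)" and s: "s > 0"
  shows "gh_dist X Y \<le> ereal s"
proof -
  have Rne: "R \<noteq> {}" using R ne by (auto simp: correspondence_def)
  have Rsub: "a \<in> mspace X" "b \<in> mspace Y" if "(a,b) \<in> R" for a b
    using R that by (auto simp: correspondence_def)
  have Rd: "\<bar>mdist X a a' - mdist Y b b'\<bar> \<le> 2 * s" if "(a,b) \<in> R" "(a',b') \<in> R" for a b a' b'
  proof -
    have "ereal \<bar>mdist X a a' - mdist Y b b'\<bar> \<le> distortion X Y R"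
      unfolding distortion_def
      by (rule SUP_upper2[where i="((a,b),(a',b'))"]) (use that in auto)
    with dis have "ereal \<bar>mdist X a a' - mdist Y b b'\<bar> \<le> ereal (2 * s)" by (rule order_trans[rotated])
    then show ?thesis by simp
  qed
  define c where "c x y = (INF p\<in>R. mdist X x (fst p) + mdist Y y (snd p) + s)" for x y
  have bdd: "bdd_below ((\<lambda>p. mdist X x (fst p) + mdist Y y (snd p) + s) ` R)" for x y
    by (rule bdd_belowI[of _ 0]) (use s in auto)
  have c_le: "c x y \<le> mdist X x a + mdist Y y b + s" if "(a,b) \<in> R" for x y a b
    unfolding c_def using cINF_lower[OF bdd that] by simp
  have c_ge: "s \<le> c x y" for x y
    unfolding c_def by (rule cINF_greatest) (use Rne in auto)
  have c_ex: "\<exists>a b. (a,b) \<in> R \<and> mdist X x a + mdist Y y b + s < c x y + e" if "e > 0" for x y e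
  proof -
    have "c x y < c x y + e" using that by simp
    then obtain p where "p \<in> R" "mdist X x (fst p) + mdist Y y (snd p) + s < c x y + e"
      unfolding c_def using cINF_less_iff[OF Rne bdd] by blast
    then show ?thesis by (metis prod.collapse)
  qed
  define d where "d u v = (case u of
      Inl x \<Rightarrow> (case v of Inl x' \<Rightarrow> mdist X x x' | Inr y \<Rightarrow> c x y)
    | Inr y \<Rightarrow> (case v of Inl x \<Rightarrow> c x y | Inr y' \<Rightarrow> mdist Y y y'))" for u v :: "'a + 'b"
  define M where "M = Inl ` mspace X \<union> Inr ` mspace Y"
  have t1: "c x y \<le> mdist X x x' + c x' y" if "x \<in> mspace X" "x' \<in> mspace X" for x x' y
  proof (rule field_le_epsilon)
    fix e :: real assume "e > 0"
    then obtain a b where ab: "(a,b) \<in> R" "mdist X x' a + mdist Y y b + s < c x' y + e"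
      using c_ex by blast
    then have "mdist X x a \<le> mdist X x x' + mdist X x' a" using that Rsub mdist_triangle by metis
    then show "c x y \<le> mdist X x x' + c x' y + e" using c_le[OF ab(1), of x y] ab(2) by linarith
  qed
  have t2: "c x y \<le> mdist Y y y' + c x y'" if "y \<in> mspace Y" "y' \<in> mspace Y" for x y y'
  proof (rule field_le_epsilon)
    fix e :: real assume "e > 0"
    then obtain a b where ab: "(a,b) \<in> R" "mdist X x a + mdist Y y' b + s < c x y' + e"
      using c_ex by blast
    then have "mdist Y y b \<le> mdist Y y y' + mdist Y y' b" using that Rsub mdist_triangle by metis
    then show "c x y \<le> mdist Y y y' + c x y' + e" using c_le[OF ab(1), of x y] ab(2) by linarith
  qed
  have t3: "mdist X x x' \<le> c x y + c x' y"
    if "x \<in> mspace X" "x' \<in> mspace X" "y \<in> mspace Y" for x x' y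
  proof (rule field_le_epsilon)
    fix e :: real assume "e > 0"
    then have e2: "e / 2 > 0" by simp
    obtain a b where ab: "(a,b) \<in> R" "mdist X x a + mdist Y y b + s < c x y + e / 2"
      using c_ex[OF e2] by blast
    obtain a' b' where ab': "(a',b') \<in> R" "mdist X x' a' + mdist Y y b' + s < c x' y + e / 2"
      using c_ex[OF e2] by blast
    have "mdist X x x' \<le> mdist X x a + mdist X a x'" "mdist X a x' \<le> mdist X a a' + mdist X a' x'"
      "mdist Y b b' \<le> mdist Y b y + mdist Y y b'"
      using that Rsub ab(1) ab'(1) by (auto intro: mdist_triangle)
    then show "mdist X x x' \<le> c x y + c x' y + e"
      using Rd[OF ab(1) ab'(1)] ab(2) ab'(2) mdist_commute[of X a' x'] mdist_commute[of Y b y]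
      unfolding abs_le_iff by linarith
  qed
  have t4: "mdist Y y y' \<le> c x y + c x y'"
    if "y \<in> mspace Y" "y' \<in> mspace Y" "x \<in> mspace X" for x y y'
  proof (rule field_le_epsilon)
    fix e :: real assume "e > 0"
    then have e2: "e / 2 > 0" by simp
    obtain a b where ab: "(a,b) \<in> R" "mdist X x a + mdist Y y b + s < c x y + e / 2"
      using c_ex[OF e2] by blast
    obtain a' b' where ab': "(a',b') \<in> R" "mdist X x a' + mdist Y y' b' + s < c x y' + e / 2"
      using c_ex[OF e2] by blast
    have "mdist Y y y' \<le> mdist Y y b + mdist Y b y'" "mdist Y b y' \<le> mdist Y b b' + mdist Y b' y'"
      "mdist X a a' \<le> mdist X a x + mdist X x a'"
      using that Rsub ab(1) ab'(1) by (auto intro: mdist_triangle)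
    then show "mdist Y y y' \<le> c x y + c x y' + e"
      using Rd[OF ab(1) ab'(1)] ab(2) ab'(2) mdist_commute[of Y b' y'] mdist_commute[of X a x]
      unfolding abs_le_iff by linarith
  qed
  have c_nn: "0 \<le> c x y" and c_nz: "c x y \<noteq> 0" for x y using c_ge[of x y] s by linarith+
  interpret Z: Metric_space M d
  proof
    fix u v w assume uvw: "u \<in> M" "v \<in> M" "w \<in> M"
    show "d u w \<le> d u v + d v w"
      using uvw unfolding M_def d_def
      by (auto intro: mdist_triangle t1 t2 t3 t4)
        (metis add.commute mdist_commute t1 t2)+
  next
    fix u v assume "u \<in> M" "v \<in> M"
    then show "(d u v = 0) = (u = v)" by (auto simp: M_def d_def c_nz)
  qed (auto simp: d_def c_nn mdist_commute split: sum.split)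
  let ?Z = "metric (M, d)"
  have mM: "Inl x \<in> M \<longleftrightarrow> x \<in> mspace X" "Inr y \<in> M \<longleftrightarrow> y \<in> mspace Y" for x y
    by (auto simp: M_def)
  have sub: "Inl ` mspace X \<subseteq> mspace ?Z" "Inr ` mspace Y \<subseteq> mspace ?Z" by (auto simp: mM)
  have iX: "isometric_metric X (submetric ?Z (Inl ` mspace X))"
    unfolding isometric_metric_def
    by (rule exI[of _ Inl]) (auto simp: bij_betw_def mM d_def)
  have iY: "isometric_metric Y (submetric ?Z (Inr ` mspace Y))"
    unfolding isometric_metric_def
    by (rule exI[of _ Inr]) (auto simp: bij_betw_def mM d_def)
  have cs: "c a b \<le> s" if "(a,b) \<in> R" for a b
    using c_le[OF that, of a b] Rsub[OF that] by (metis add_0 mdist_zero)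
  have "hausdorff_dist ?Z (Inl ` mspace X) (Inr ` mspace Y) \<le> ereal s"
  proof (rule ereal_le_epsilon2)
    fix e :: real assume e: "e > 0"
    have "\<exists>y. y \<in> mspace Y \<and> c x y < s + e" if "x \<in> mspace X" for x
    proof -
      from that R obtain y where "(x,y) \<in> R" by (force simp: correspondence_def)
      then show ?thesis using cs[of x y] Rsub[of x y] e by force
    qed
    moreover have "\<exists>x. x \<in> mspace X \<and> c x y < s + e" if "y \<in> mspace Y" for y
    proof -
      from that R obtain x where "(x,y) \<in> R" by (force simp: correspondence_def)
      then show ?thesis using cs[of x y] Rsub[of x y] e by force
    qed
    ultimately have "Inl ` mspace X \<subseteq> (\<Union>b\<in>Inr ` mspace Y. mball_of ?Z b (s + e))"
      "Inr ` mspace Y \<subseteq> (\<Union>b\<in>Inl ` mspace X. mball_of ?Z b (s + e))"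
      by (auto simp: mM d_def) blast+
    then have "hausdorff_dist ?Z (Inl ` mspace X) (Inr ` mspace Y) \<le> ereal (s + e)"
      unfolding hausdorff_dist_def using s e by (intro Inf_lower) auto
    then show "hausdorff_dist ?Z (Inl ` mspace X) (Inr ` mspace Y) \<le> ereal s + ereal e" by simp
  qed
  then show ?thesis
    unfolding gh_dist_def using sub iX iY by (intro Inf_lower) blast
qed

lemma hausdorff_dist_nonneg: "0 \<le> hausdorff_dist Z A B"
  unfolding hausdorff_dist_def by (rule Inf_greatest) auto

lemma gh_dist_le:
  fixes X :: "'a metric" and Y :: "'b metric" and Z :: "'c metric"
  assumes "mspace X \<noteq> {}" "X' \<subseteq> mspace Z" "Y' \<subseteq> mspace Z"
    and "isometric_metric X (submetric Z X')" "isometric_metric Y (submetric Z Y')"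
  shows "gh_dist X Y \<le> hausdorff_dist Z X' Y'"
proof (rule dense_ge)
  fix t assume t: "hausdorff_dist Z X' Y' < t"
  show "gh_dist X Y \<le> t"
  proof (cases t)
    case (real r)
    obtain R where R: "correspondence (mspace X) (mspace Y) R" "distortion X Y R \<le> ereal (2 * r)"
      using hausdorff_correspondence[OF assms(2-5)] t real by blast
    have "0 < ereal r" using hausdorff_dist_nonneg t real by (metis order_le_less_trans)
    then show ?thesis using correspondence_gh_dist_le[OF R(1) assms(1) R(2)] real by simp
  qed (use t in auto)
qed

lemma gh_dist_nonneg: "0 \<le> gh_dist X Y"
  unfolding gh_dist_def
  by (rule Inf_greatest) (use hausdorff_dist_nonneg order_trans in blast)

lemma gh_dist_eq_distortion:
  fixes X :: "'a metric" and Y :: "'b metric"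
  assumes "mspace X \<noteq> {}"
  shows "2 * gh_dist X Y = (INF R \<in> {R. correspondence (mspace X) (mspace Y) R}. distortion X Y R)"
    (is "_ = ?I")
proof (rule antisym)
  show "2 * gh_dist X Y \<le> ?I"
  proof (rule INF_greatest)
    fix R assume "R \<in> {R. correspondence (mspace X) (mspace Y) R}"
    then have R: "correspondence (mspace X) (mspace Y) R" by simp
    then obtain p where p: "p \<in> R" using assms unfolding correspondence_def by blast
    have "0 \<le> distortion X Y R"
      unfolding distortion_def by (rule SUP_upper2[of "(p,p)"]) (use p in auto)
    show "2 * gh_dist X Y \<le> distortion X Y R"
    proof (rule dense_ge)
      fix t assume t: "distortion X Y R < t"
      show "2 * gh_dist X Y \<le> t"
      proof (cases t)
        case (real r)
        have "0 < ereal r" using t real \<open>0 \<le> distortion X Y R\<close> by (metis order_le_less_trans)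
        then have "gh_dist X Y \<le> ereal (r / 2)"
          using correspondence_gh_dist_le[OF R assms, of "r/2"] t real by simp
        then have "2 * gh_dist X Y \<le> 2 * ereal (r / 2)" by (intro ereal_mult_left_mono) auto
        then show ?thesis using real by simp
      qed (use t in auto)
    qed
  qed
  have "?I \<le> ereal (2 * r)" if lt: "gh_dist X Y < ereal r" for r
  proof -
    obtain q and Z :: "('a + 'b) metric" and X' Y' where Z: "q < r"
      "X' \<subseteq> mspace Z" "Y' \<subseteq> mspace Z"
      "isometric_metric X (submetric Z X')" "isometric_metric Y (submetric Z Y')"
      "hausdorff_dist Z X' Y' \<le> ereal q"
      using lt unfolding gh_dist_def Inf_less_iff by (auto; blast)
    have "hausdorff_dist Z X' Y' < ereal r"
      using Z(1,6) by (metis ereal_less_eq(3) less_ereal.simps(1) order_le_less_trans)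
    then obtain R where "correspondence (mspace X) (mspace Y) R" "distortion X Y R \<le> ereal (2 * r)"
      using hausdorff_correspondence[OF Z(2-5)] by blast
    then show ?thesis by (auto intro: INF_lower2)
  qed
  note le = this
  show "?I \<le> 2 * gh_dist X Y"
  proof (cases "gh_dist X Y")
    case (real g)
    have "?I \<le> ereal (2 * g)"
    proof (rule ereal_le_epsilon2)
      fix e :: real assume "e > 0"
      then show "?I \<le> ereal (2 * g) + ereal e" using le[of "g + e / 2"] real by (simp add: algebra_simps)
    qed
    then show ?thesis using real by simp
  qed (use gh_dist_nonneg[of X Y] in auto)
qed

end

theory Submission
  imports Defs
begin

text \<open>The full correspondence gives the upper bound. For the lower bound, a correspondence between
  \<open>X\<close> and \<open>Y\<close> of distortion \<open>r < diam Y\<close> partitions \<open>Y\<close> into at most \<open>#X < m\<close> parts of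
  diameter at most \<open>r\<close>. As \<open>m \<le> #Y\<close>, the partition refines to one with exactly \<open>m\<close> parts, which
  is a correspondence between \<open>\<lambda>\<Delta>\<^sub>m\<close> and \<open>Y\<close> of distortion at most
  \<open>max {r, \<lambda>, diam Y - \<lambda>} < diam Y\<close>.\<close>

text \<open>Inside \<open>Y\<close> there is a copy of \<open>M\<close>, and its union with
  \<open>T\<close> contains \<open>T\<close>. If \<open>M\<close> is infinite, this union already
  has the right size; if \<open>M\<close> is finite, it may be too large and is trimmed without
  losing points of \<open>T\<close>.\<close>

lemma eqpoll_subset_between:
  assumes "T \<subseteq> Y" "T \<lesssim> M" "M \<lesssim> Y"
  obtains S where "T \<subseteq> S" "S \<subseteq> Y" "S \<approx> M"
proof -
  obtain i where i: "inj_on i M" "i ` M \<subseteq> Y"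
    using assms(3) unfolding lepoll_def by blast
  have iM: "i ` M \<approx> M" using i(1) by (simp add: inj_on_image_eqpoll_self)
  show ?thesis
  proof (cases "finite M")
    case True
    obtain j where j: "inj_on j T" "j ` T \<subseteq> M"
      using assms(2) unfolding lepoll_def by blast
    have T: "finite T" using inj_on_finite[OF j True] .
    have TM: "card T \<le> card M" using card_inj_on_le[OF j True] .
    have "card M \<le> card (T \<union> i ` M)"
      using i(1) True T by (metis card_image card_mono finite_UnI finite_imageI sup_ge2)
    then obtain S where "T \<subseteq> S" "S \<subseteq> T \<union> i ` M" "card S = card M"
      using exists_subset_between[OF TM, of "T \<union> i ` M"] T True by auto
    moreover have "finite S" using calculation T True finite_subset by blast
    ultimately show ?thesis
      using that[of S] True assms(1) i(2) eqpoll_iff_card[of S M] by blast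
  next
    case False
    \<comment> \<open>Absorption: an infinite set keeps its cardinality when a set that is no larger
      is added.\<close>
    have "ordLeq3 (card_of T) (card_of (i ` M))"
      using lepoll_trans2[OF assms(2) eqpoll_sym[OF iM]] by (simp add: lepoll_def card_of_ordLeq)
    moreover have "infinite (i ` M)" using False i(1) by (simp add: finite_image_iff)
    ultimately have "ordLeq3 (card_of (T \<union> i ` M)) (card_of (i ` M))"
      by (intro card_of_Un_ordLeq_infinite_Field) (simp_all add: Field_card_of card_of_card_order_on ordLeq_refl)
    then have "T \<union> i ` M \<lesssim> i ` M" by (simp add: lepoll_def card_of_ordLeq)
    then have "T \<union> i ` M \<approx> i ` M" by (simp add: lepoll_antisym subset_imp_lepoll)
    then show ?thesis using that[of "T \<union> i ` M"] iM assms(1) i(2) eqpoll_trans by blast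
  qed
qed

text \<open>The fibres of \<open>f\<close> partition \<open>Y\<close>; splitting points off them, as
  \<open>M\<close> \<lesssim> \<open>Y\<close> permits, yields exactly as many parts as
  \<open>M\<close> has elements.\<close>

lemma surjective_refinement:
  assumes "f ` Y \<lesssim> M" "M \<lesssim> Y"
  obtains g where "g ` Y = M" "\<And>y y'. y \<in> Y \<Longrightarrow> y' \<in> Y \<Longrightarrow> g y = g y' \<Longrightarrow> f y = f y'"
proof -
  \<comment> \<open>\<open>t\<close> moves each point to a chosen representative of its fibre, so
    its image is a transversal.\<close>
  define t where "t = (\<lambda>y. inv_into Y f (f y))"
  have t: "t y \<in> Y" "f (t y) = f y" if "y \<in> Y" for y
    using that unfolding t_def by (auto intro: inv_into_into f_inv_into_f)
  have "t ` Y \<lesssim> f ` Y"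
    unfolding t_def by (metis image_image image_lepoll)
  then obtain S where S: "t ` Y \<subseteq> S" "S \<subseteq> Y" "S \<approx> M"
    using eqpoll_subset_between[of "t ` Y" Y M] t(1) assms lepoll_trans by blast
  then obtain b where b: "bij_betw b S M" unfolding eqpoll_def by blast
  \<comment> \<open>\<open>S\<close> contains all representatives, so \<open>h\<close> retracts
    \<open>Y\<close> onto \<open>S\<close> without leaving any fibre of \<open>f\<close>.\<close>
  define h where "h = (\<lambda>y. if y \<in> S then y else t y)"
  have h: "h ` Y = S" using S(1,2) by (force simp: h_def)
  have fh: "f (h y) = f y" if "y \<in> Y" for y using t(2) that by (simp add: h_def)
  show ?thesis
  proof (rule that[of "b \<circ> h"])
    show "(b \<circ> h) ` Y = M" using h b by (metis bij_betw_imp_surj_on image_comp)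
    fix y y' assume "y \<in> Y" "y' \<in> Y" "(b \<circ> h) y = (b \<circ> h) y'"
    moreover from this have "h y = h y'"
      using b h by (auto simp: bij_betw_def dest: inj_onD)
    ultimately show "f y = f y'" using fh by metis
  qed
qed

lemma mdist_le_mdiam:
  "x \<in> mspace X \<Longrightarrow> y \<in> mspace X \<Longrightarrow> ereal (mdist X x y) \<le> mdiam X"
  unfolding mdiam_def by (rule SUP_upper2[of "(x, y)"]) auto

lemma mdiam_bounded_metric:
  assumes "bounded_metric X" "mspace X \<noteq> {}"
  obtains D where "mdiam X = ereal D"
proof -
  obtain x where x: "x \<in> mspace X" using assms(2) by blast
  obtain B where B: "\<And>x y. x \<in> mspace X \<Longrightarrow> y \<in> mspace X \<Longrightarrow> mdist X x y \<le> B"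
    using assms(1) unfolding bounded_metric_def
      Metric_space.mbounded_alt[OF Metric_space_mspace_mdist] by blast
  have "mdiam X \<le> ereal B" unfolding mdiam_def by (rule SUP_least) (use B in auto)
  \<comment> \<open>A point is needed here: over an empty carrier the supremum would be
    -\<infinity>.\<close>
  moreover have "0 \<le> mdiam X" using mdist_le_mdiam[OF x x] mdist_zero[OF x x] by (simp add: zero_ereal_def)
  ultimately show ?thesis using that by (cases "mdiam X") auto
qed

lemma distortion_upper:
  assumes "(x, y) \<in> R" "(x', y') \<in> R"
  shows "ereal \<bar>mdist X x x' - mdist Y y y'\<bar> \<le> distortion X Y R"
  unfolding distortion_def by (rule SUP_upper2[of "((x, y), (x', y'))"]) (use assms in auto)

lemma distortion_leI:
  assumes "\<And>x y x' y'. (x, y) \<in> R \<Longrightarrow> (x', y') \<in> R \<Longrightarrow>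
    ereal \<bar>mdist X x x' - mdist Y y y'\<bar> \<le> c"
  shows "distortion X Y R \<le> c"
  unfolding distortion_def by (rule SUP_least) (use assms in auto)

text \<open>In the full product, each distortion term is a difference of two nonnegative distances,
  hence at most the larger of them.\<close>

lemma gh_dist_le_max_mdiam:
  assumes "mspace X \<noteq> {}" "mspace Y \<noteq> {}"
  shows "2 * gh_dist X Y \<le> max (mdiam X) (mdiam Y)"
proof -
  let ?R = "mspace X \<times> mspace Y"
  have "distortion X Y ?R \<le> max (mdiam X) (mdiam Y)"
  proof (rule distortion_leI)
    fix x y x' y' assume m: "(x, y) \<in> ?R" "(x', y') \<in> ?R"
    have "\<bar>mdist X x x' - mdist Y y y'\<bar> \<le> max (mdist X x x') (mdist Y y y')"
      using mdist_nonneg[of X x x'] mdist_nonneg[of Y y y'] by linarith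
    then have "ereal \<bar>mdist X x x' - mdist Y y y'\<bar>
        \<le> max (ereal (mdist X x x')) (ereal (mdist Y y y'))"
      by (simp add: le_max_iff_disj)
    also have "\<dots> \<le> max (mdiam X) (mdiam Y)"
      using m by (intro max.mono mdist_le_mdiam) auto
    finally show "ereal \<bar>mdist X x x' - mdist Y y y'\<bar> \<le> max (mdiam X) (mdiam Y)" .
  qed
  moreover have "correspondence (mspace X) (mspace Y) ?R"
    using assms by (simp add: correspondence_def)
  ultimately show ?thesis
    unfolding gh_dist_eq_distortion[OF assms(1)] by (auto intro: INF_lower2)
qed

text \<open>Used in contrapositive form: where the conclusion fails, no correspondence between
  \<open>X\<close> and \<open>Y\<close> has distortion below \<open>mdiam Y\<close>.\<close>

lemma gh_dist_single_distance_less_mdiam: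
  fixes X :: "'a metric" and Y :: "'b metric" and M :: "'c set"
  assumes "bounded_metric Y" "mspace Y \<noteq> {}" "M \<noteq> {}" "0 < l" "ereal l < mdiam Y"
    and "mspace X \<lesssim> M" "M \<lesssim> mspace Y"
    and R: "correspondence (mspace X) (mspace Y) R" and less: "distortion X Y R < mdiam Y"
  shows "2 * gh_dist (scale_metric l (single_distance_metric M)) Y < mdiam Y"
proof -
  let ?L = "scale_metric l (single_distance_metric M)"
  obtain D where D: "mdiam Y = ereal D" using mdiam_bounded_metric assms(1,2) by blast
  \<comment> \<open>The first entry handles pairs with equal labels in \<open>M\<close>; the other
    two bound the difference between \<open>l\<close> and a distance in [0, \<open>D\<close>], for
    distinct labels.\<close>
  define c where "c = max (distortion X Y R) (max (ereal l) (ereal (D - l)))"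
  have "\<forall>y\<in>mspace Y. \<exists>x. (x, y) \<in> R" using R by (force simp: correspondence_def)
  \<comment> \<open>\<open>R\<close> may relate a point to many others; fixing one partner makes it
    a map whose fibres have diameter at most the distortion of \<open>R\<close>.\<close>
  then obtain f where f: "\<And>y. y \<in> mspace Y \<Longrightarrow> (f y, y) \<in> R" by metis
  have fX: "f y \<in> mspace X" if "y \<in> mspace Y" for y
    using f[OF that] R by (auto simp: correspondence_def)
  then have "f ` mspace Y \<lesssim> M" using assms(6) by (meson image_subsetI lepoll_trans subset_imp_lepoll)
  then obtain g where g: "g ` mspace Y = M"
    "\<And>y y'. y \<in> mspace Y \<Longrightarrow> y' \<in> mspace Y \<Longrightarrow> g y = g y' \<Longrightarrow> f y = f y'"
    using surjective_refinement assms(7) by blast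
  define Q where "Q = (\<lambda>y. (g y, y)) ` mspace Y"
  have Q: "correspondence (mspace ?L) (mspace Y) Q"
    using g(1) assms(4) by (auto simp: correspondence_def Q_def image_image)
  have "distortion ?L Y Q \<le> c"
  proof (rule distortion_leI)
    fix m y m' y' assume "(m, y) \<in> Q" "(m', y') \<in> Q"
    then have m: "m = g y" "m' = g y'" and y: "y \<in> mspace Y" "y' \<in> mspace Y"
      by (auto simp: Q_def)
    show "ereal \<bar>mdist ?L m m' - mdist Y y y'\<bar> \<le> c"
    proof (cases "m = m'")
      case True
      then have "f y = f y'" using g(2) m y by blast
      then have "ereal \<bar>mdist ?L m m' - mdist Y y y'\<bar>
          = ereal \<bar>mdist X (f y) (f y') - mdist Y y y'\<bar>"
        using True assms(4) mdist_zero[OF fX fX, OF y(2) y(2)] by simp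
      also have "\<dots> \<le> distortion X Y R" by (intro distortion_upper f y)
      finally show ?thesis by (simp add: c_def le_max_iff_disj)
    next
      case False
      have "mdist Y y y' \<le> D" using mdist_le_mdiam[OF y] D by simp
      then have "\<bar>l - mdist Y y y'\<bar> \<le> max l (D - l)"
        using assms(4) mdist_nonneg[of Y y y'] by linarith
      then show ?thesis using False assms(4) by (simp add: c_def le_max_iff_disj)
    qed
  qed
  \<comment> \<open>Strictness of the last two entries comes from \<open>l\<close> <
    \<open>D\<close> and from 0 < \<open>l\<close>, respectively.\<close>
  moreover have "c < mdiam Y" using less assms(4,5) D by (simp add: c_def)
  moreover have "2 * gh_dist ?L Y \<le> distortion ?L Y Q"
    using Q assms(3,4) by (subst gh_dist_eq_distortion) (auto intro: INF_lower)
  ultimately show ?thesis by simp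
qed

theorem corollary4p6:
  fixes X :: "'a metric" and Y :: "'b metric" and M :: "'c set" and l :: real
  assumes "mspace X \<noteq> {}" and "mspace Y \<noteq> {}"
    and "bounded_metric X" and "bounded_metric Y"
    and "mdiam X \<le> mdiam Y"
    and "0 < l" and "ereal l < mdiam Y"
    and "mspace X \<prec> M" and "M \<lesssim> mspace Y"
    and "2 * gh_dist (scale_metric l (single_distance_metric M)) Y = mdiam Y"
  shows "2 * gh_dist X Y = mdiam Y"
proof (rule antisym)
  show "2 * gh_dist X Y \<le> mdiam Y"
    using gh_dist_le_max_mdiam[OF assms(1,2)] assms(5) by (simp add: max_absorb2)
  have le: "mspace X \<lesssim> M" using assms(8) by (rule lesspoll_imp_lepoll)
  then have ne: "M \<noteq> {}" using assms(1) by (auto simp: lepoll_empty_iff_empty)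
  show "mdiam Y \<le> 2 * gh_dist X Y"
    unfolding gh_dist_eq_distortion[OF assms(1)]
  proof (rule INF_greatest)
    fix R assume "R \<in> {R. correspondence (mspace X) (mspace Y) R}"
    then show "mdiam Y \<le> distortion X Y R"
      using gh_dist_single_distance_less_mdiam[OF assms(4,2) ne assms(6,7) le assms(9)] assms(10)
      by (metis less_irrefl mem_Collect_eq not_le)
  qed
qed

end
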